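(* Let $R=\mathcal{O}_{\mathbb{Q}(\sqrt{-15})}$. Every maximal connected cyclotomic $\mathcal{L}$-graph over $R$ that is not equivalent to a charged signed graph is equivalent either to $S_2$, the $2$-vertex $\mathcal{L}$-graph with matrix $\begin{pmatrix}0&2\\2&0\end{pmatrix}$, or to $S_2^*$, the $2$-vertex $\mathcal{L}$-graph with matrix $\begin{pmatrix}0&\omega\\ \bar\omega&0\end{pmatrix}$ where $\omega=\frac12+\frac{\sqrt{-15}}{2}$.
   Context: Let $d<0$ be squarefree, $R=\mathcal{O}_{\mathbb{Q}(\sqrt{d})}$, and for $n\ge1$ let $\mathcal{L}_n=\{x\in R: x\bar x=n\}$, $\mathcal{L}=\{0\}\cup\mathcal{L}_1\cup\mathcal{L}_2\cup\mathcal{L}_3\cup\mathcal{L}_4$. A (charged) $\mathcal{L}$-graph on $n$ vertices is identified with an $n\times n$ Hermitian matrix $A$ whose diagonal entries (charges) lie in $\{0,1,-1\}$ and whose off-diagonal entries lie in $\mathcal{L}$. The graph is cyclotomic if all eigenvalues of $A$ lie in $[-2,2]$, connected if $A$ is not permutation-similar to a block diagonal matrix with more than one block. $H$ is contained in $G$ if the matrix of $H$ is obtained from that of $G$ by deleting some rows and the corresponding columns. A connected cyclotomic $\mathcal{L}$-graph is maximal if it is not contained in a strictly larger connected cyclotomic $\mathcal{L}$-graph. Matrices $A,A'$ are equivalent if $A'=DPXP^{T}D$ for some $X\in\{A,-A,\bar A,-\bar A\}$, permutation matrix $P$ and diagonal matrix $D$ with diagonal entries $\pm1$. A charged signed graph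 is an $\mathcal{L}$-graph all of whose entries lie in $\{0,1,-1\}$. *)

theory Defs
  imports
    "Jordan_Normal_Form.Char_Poly"
    "Jordan_Normal_Form.Schur_Decomposition"
    "Jordan_Normal_Form.DL_Submatrix"
    "HOL-Computational_Algebra.Polynomial"
    "HOL-Combinatorics.Permutations"
begin

definition quadratic_field :: "int \<Rightarrow> complex set" where
  "quadratic_field d = {of_rat a + of_rat b * csqrt (of_int d) | a b. True}"

definition quadratic_integers :: "int \<Rightarrow> complex set" where
  "quadratic_integers d = {x \<in> quadratic_field d. algebraic_int x}"

definition norm_layer :: "int \<Rightarrow> nat \<Rightarrow> complex set" where
  "norm_layer d n = {x \<in> quadratic_integers d. x * cnj x = of_nat n}"

definition labels :: "int \<Rightarrow> complex set" where
  "labels d = {0} \<union> norm_layer d 1 \<union> norm_layer d 2 \<union> norm_layer d 3 \<union> norm_layer d 4"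

definition hermitian_mat :: "complex mat \<Rightarrow> bool" where
  "hermitian_mat A \<longleftrightarrow> square_mat A \<and> mat_adjoint A = A"

definition L_graph :: "int \<Rightarrow> complex mat \<Rightarrow> bool" where
  "L_graph d A \<longleftrightarrow> hermitian_mat A \<and>
     (\<forall>i < dim_row A. A $$ (i, i) \<in> {0, 1, -1}) \<and>
     (\<forall>i < dim_row A. \<forall>j < dim_row A. i \<noteq> j \<longrightarrow> A $$ (i, j) \<in> labels d)"

definition charged_signed_graph :: "int \<Rightarrow> complex mat \<Rightarrow> bool" where
  "charged_signed_graph d A \<longleftrightarrow> L_graph d A \<and> elements_mat A \<subseteq> {0, 1, -1}"

definition cyclotomic :: "complex mat \<Rightarrow> bool" where
  "cyclotomic A \<longleftrightarrow> (\<forall>k. eigenvalue A k \<longrightarrow> k \<in> complex_of_real ` {-2..2})"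

definition permutation_mat :: "nat \<Rightarrow> complex mat \<Rightarrow> bool" where
  "permutation_mat n P \<longleftrightarrow>
     (\<exists>p. p permutes {..<n} \<and> P = mat n n (\<lambda>(i, j). if i = p j then 1 else 0))"

definition sign_mat :: "nat \<Rightarrow> complex mat \<Rightarrow> bool" where
  "sign_mat n D \<longleftrightarrow> D \<in> carrier_mat n n \<and> diagonal_mat D \<and> (\<forall>i < n. D $$ (i, i) \<in> {1, -1})"

(* Blocks are nonempty; otherwise every matrix would be block diagonal with several blocks. *)
definition connected_mat :: "complex mat \<Rightarrow> bool" where
  "connected_mat A \<longleftrightarrow>
     \<not> (\<exists>P Bs. permutation_mat (dim_row A) P \<and> length Bs > 1 \<and>
          (\<forall>B \<in> set Bs. square_mat B \<and> dim_row B > 0) \<and>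
          P * A * transpose_mat P = diag_block_mat Bs)"

definition contained_in :: "complex mat \<Rightarrow> complex mat \<Rightarrow> bool" where
  "contained_in H G \<longleftrightarrow> (\<exists>I \<subseteq> {..<dim_row G}. H = submatrix G I I)"

definition connected_cyclotomic_L_graph :: "int \<Rightarrow> complex mat \<Rightarrow> bool" where
  "connected_cyclotomic_L_graph d A \<longleftrightarrow> L_graph d A \<and> cyclotomic A \<and> connected_mat A"

definition maximal_L_graph :: "int \<Rightarrow> complex mat \<Rightarrow> bool" where
  "maximal_L_graph d A \<longleftrightarrow> connected_cyclotomic_L_graph d A \<and>
     \<not> (\<exists>G. connected_cyclotomic_L_graph d G \<and> dim_row G > dim_row A \<and> contained_in A G)"

definition equivalent_mat :: "complex mat \<Rightarrow> complex mat \<Rightarrow> bool" where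
  "equivalent_mat A A' \<longleftrightarrow>
     (\<exists>X P D. X \<in> {A, - A, map_mat cnj A, - map_mat cnj A} \<and>
        permutation_mat (dim_row A) P \<and> sign_mat (dim_row A) D \<and>
        A' = D * P * X * transpose_mat P * D)"

definition omega :: complex where
  "omega = 1 / 2 + csqrt (-15) / 2"

definition S2 :: "complex mat" where
  "S2 = mat_of_rows_list 2 [[0, 2], [2, 0]]"

definition S2_star :: "complex mat" where
  "S2_star = mat_of_rows_list 2 [[0, omega], [cnj omega, 0]]"

end

theory Submission
  imports Defs "Jordan_Normal_Form.Spectral_Radius"
begin

text \<open>
  In the ring of integers of \<open>\<rat>(\<surd>-15)\<close> the norm form represents neither 2 nor 3, so every label
  other than \<open>0, \<plusminus>1\<close> has norm 4 and is one of \<open>\<plusminus>2, \<plusminus>\<omega>, \<plusminus>cnj \<omega>\<close>. For a Hermitian matrix with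
  spectrum in \<open>[-2, 2]\<close> the squared norm of each row is at most 4. Hence an entry of norm 4
  is the only nonzero entry of its row and of its column, and by connectedness the graph has just
  two vertices. If there is no such entry, the matrix already is a charged signed graph.
\<close>

section \<open>Integral elements of norm at most 4\<close>

text \<open>Newton's recurrence expresses each power sum through the two preceding ones, with
  coefficients \<open>x + y\<close> and \<open>x * y\<close>. Since the trace is only assumed
  rational, the recurrence propagates rationality but not integrality.\<close>

lemma power_sum_Rats:
  fixes x y :: complex
  assumes "x + y \<in> \<rat>" "x * y \<in> \<int>"
  shows "x ^ k + y ^ k \<in> \<rat>"
proof (induction k rule: less_induct)
  case (less k)
  show ?case
  proof (cases "k < 2")
    case True
    then have "k = 0 \<or> k = 1" by auto
    then show ?thesis using assms by auto
  next
    case False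
    then obtain m where k: "k = Suc (Suc m)"
      by (metis add_2_eq_Suc le_Suc_ex not_less)
    have "x ^ k + y ^ k = (x + y) * (x ^ Suc m + y ^ Suc m) - x * y * (x ^ m + y ^ m)"
      by (simp add: k algebra_simps)
    moreover have "x * y \<in> \<rat>" using assms(2) Ints_subset_Rats by blast
    ultimately show ?thesis
      using less[of "Suc m"] less[of m] assms(1) k by simp
  qed
qed

text \<open>The monic equation times \<open>x ^ j\<close>, solved for its top term: a linear
  recurrence for the powers of a root.\<close>

lemma monic_root_power:
  fixes x :: "'a :: comm_ring_1"
  assumes "lead_coeff p = 1" "poly p x = 0"
  shows "x ^ (degree p + j) = - (\<Sum>i<degree p. coeff p i * x ^ (i + j))"
proof -
  have "0 = x ^ j * (\<Sum>i\<le>degree p. coeff p i * x ^ i)"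
    using assms by (simp add: poly_altdef)
  also have "\<dots> = (\<Sum>i\<le>degree p. coeff p i * x ^ (i + j))"
    by (simp add: sum_distrib_left power_add ac_simps)
  also have "\<dots> = (\<Sum>i<degree p. coeff p i * x ^ (i + j)) + x ^ (degree p + j)"
    using assms by (simp flip: lessThan_Suc_atMost)
  finally show ?thesis by (simp add: eq_neg_iff_add_eq_0 add.commute)
qed

text \<open>Clears denominators of finitely many initial values; below these are the first
  \<open>degree p\<close> power sums.\<close>

lemma Rats_common_denominator:
  fixes f :: "nat \<Rightarrow> 'a :: field_char_0"
  assumes "\<And>k. f k \<in> \<rat>"
  shows "\<exists>N::int. N > 0 \<and> (\<forall>k<m. of_int N * f k \<in> \<int>)"
proof (induction m)
  case 0
  show ?case by (intro exI[of _ 1]) auto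
next
  case (Suc m)
  then obtain N :: int where N: "N > 0" "\<forall>k<m. of_int N * f k \<in> \<int>" by auto
  obtain a b where ab: "b > 0" "f m = of_int a / of_int b"
    using assms[of m] by (meson Rats_cases')
  have "of_int (N * b) * f k \<in> \<int>" if "k < Suc m" for k
  proof (cases "k = m")
    case True
    have "of_int (N * b) * f m = (of_int (N * a) :: 'a)" using ab by simp
    then show ?thesis using True by (metis Ints_of_int)
  next
    case False
    then have "of_int N * f k \<in> \<int>" using N that by simp
    then have "of_int b * (of_int N * f k) \<in> \<int>" by (rule Ints_mult[OF Ints_of_int])
    then show ?thesis by (simp add: ac_simps)
  qed
  then show ?case using N ab by (intro exI[of _ "N * b"]) auto
qed

text \<open>Both roots obey the same recurrence, whose coefficients are integers, and hence so do
  the power sums. A common denominator of the first \<open>degree p\<close> of them therefore serves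
  all.\<close>

lemma power_sum_bounded_denominator:
  fixes x y :: complex and p :: "complex poly"
  assumes p: "lead_coeff p = 1" "\<forall>i. coeff p i \<in> \<int>" "poly p x = 0" "poly p y = 0"
    and "x + y \<in> \<rat>" "x * y \<in> \<int>"
  obtains N :: int where "N > 0" "\<And>k. of_int N * (x ^ k + y ^ k) \<in> \<int>"
proof -
  obtain N :: int where N: "N > 0" "\<forall>k<degree p. of_int N * (x ^ k + y ^ k) \<in> \<int>"
    using Rats_common_denominator[of "\<lambda>k. x ^ k + y ^ k" "degree p"] power_sum_Rats assms by blast
  have "of_int N * (x ^ k + y ^ k) \<in> \<int>" for k
  proof (induction k rule: less_induct)
    case (less k)
    show ?case
    proof (cases "k < degree p")
      case True
      then show ?thesis using N by blast
    next
      case False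
      define j where "j = k - degree p"
      have k: "k = degree p + j" using False by (simp add: j_def)
      have xy: "x ^ k + y ^ k = - (\<Sum>i<degree p. coeff p i * (x ^ (i + j) + y ^ (i + j)))"
        unfolding k monic_root_power[OF p(1,3)] monic_root_power[OF p(1,4)]
        by (simp add: distrib_left sum.distrib)
      have "of_int N * (x ^ k + y ^ k) =
          - (\<Sum>i<degree p. coeff p i * (of_int N * (x ^ (i + j) + y ^ (i + j))))"
        unfolding xy by (simp only: mult_minus_right sum_distrib_left mult.left_commute)
      also have "\<dots> \<in> \<int>"
      proof (rule Ints_minus, rule Ints_sum, rule Ints_mult)
        fix i assume "i \<in> {..<degree p}"
        then show "of_int N * (x ^ (i + j) + y ^ (i + j)) \<in> \<int>" by (intro less) (simp add: k)
      qed (use p in blast)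
      finally show ?thesis .
    qed
  qed
  with N show ?thesis using that by blast
qed

text \<open>If the trace were \<open>c/e\<close> in lowest terms, the power sums with exponent \<open>2 ^ k\<close> would have
  exact denominator \<open>e ^ 2 ^ k\<close>, but a monic integer equation bounds their denominators.\<close>

lemma algebraic_int_trace_Ints:
  fixes x :: complex
  assumes "algebraic_int x" and tr: "x + cnj x \<in> \<rat>" and nm: "x * cnj x \<in> \<int>"
  shows "x + cnj x \<in> \<int>"
proof -
  obtain q :: "int poly" where q: "poly (map_poly of_int q) x = 0" "lead_coeff q = 1"
    using assms(1) algebraic_int_altdef_ipoly by blast
  define p :: "complex poly" where "p = map_poly of_int q"
  have p: "lead_coeff p = 1" "\<forall>i. coeff p i \<in> \<int>" "poly p x = 0"
    using q by (auto simp: p_def coeff_map_poly degree_map_poly)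
  \<comment> \<open>The coefficients are real, so conjugation carries roots to roots.\<close>
  have "poly p (cnj x) = cnj (poly p x)"
    by (simp add: poly_altdef p_def coeff_map_poly)
  then have pc: "poly p (cnj x) = 0" using p by simp
  obtain N :: int where N: "N > 0" "\<And>k. of_int N * (x ^ k + cnj x ^ k) \<in> \<int>"
    using power_sum_bounded_denominator[OF p pc tr nm] by blast
  obtain n where n: "x * cnj x = of_int n" using nm by (auto elim: Ints_cases)
  obtain c e where e: "e > 0" "coprime c e" "x + cnj x = of_int c / of_int e"
    using tr by (meson Rats_cases')
  \<comment> \<open>Passing from \<open>k\<close> to \<open>Suc k\<close> squares the numerator
    \<open>b\<close> up to the correction \<open>2 * (u * v) * w\<^sup>2\<close>. This is a multiple
    of \<open>e\<close>, because \<open>u * v\<close> is an integer and \<open>e\<close> divides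
    \<open>w\<^sup>2\<close>, so coprimality to \<open>e\<close> survives.\<close>
  have *: "\<exists>b::int. coprime b e \<and> (x ^ 2 ^ k + cnj x ^ 2 ^ k) * of_int (e ^ 2 ^ k) = of_int b" for k
  proof (induction k)
    case 0
    then show ?case using e by auto
  next
    case (Suc k)
    then obtain b :: int where b: "coprime b e"
      "(x ^ 2 ^ k + cnj x ^ 2 ^ k) * of_int (e ^ 2 ^ k) = of_int b" by blast
    define u v w where "u = x ^ 2 ^ k" and "v = cnj x ^ 2 ^ k" and "w = (of_int (e ^ 2 ^ k) :: complex)"
    have uv: "u * v = of_int (n ^ 2 ^ k)"
      by (simp add: u_def v_def n flip: power_mult_distrib)
    have "e dvd (e ^ 2 ^ k)\<^sup>2" by (simp add: power2_eq_square dvd_power)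
    then obtain d where d: "(e ^ 2 ^ k)\<^sup>2 = e * d" by blast
    have "(x ^ 2 ^ Suc k + cnj x ^ 2 ^ Suc k) * of_int (e ^ 2 ^ Suc k) = (u\<^sup>2 + v\<^sup>2) * w\<^sup>2"
      unfolding u_def v_def w_def by (simp add: power_mult[symmetric] mult.commute)
    also have "\<dots> = ((u + v) * w)\<^sup>2 - 2 * (u * v) * w\<^sup>2"
      by (simp add: power2_eq_square algebra_simps)
    also have "\<dots> = of_int (b\<^sup>2 - e * (2 * n ^ 2 ^ k * d))"
    proof -
      have "w\<^sup>2 = of_int (e * d)" unfolding w_def d[symmetric] by simp
      moreover have "(u + v) * w = of_int b" using b(2) by (simp only: u_def v_def w_def)
      ultimately show ?thesis by (simp add: uv)
    qed
    finally have "(x ^ 2 ^ Suc k + cnj x ^ 2 ^ Suc k) * of_int (e ^ 2 ^ Suc k) =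
        of_int (b\<^sup>2 - e * (2 * n ^ 2 ^ k * d))" .
    moreover have "coprime (b\<^sup>2) e" using b(1) by simp
    then have "coprime (b\<^sup>2 - e * (2 * n ^ 2 ^ k * d)) e"
      by (auto simp: coprime_def dvd_diff_left_iff)
    ultimately show ?case by blast
  qed
  have "e ^ 2 ^ k \<le> N" for k
  proof -
    obtain b :: int where b: "coprime b e"
      "(x ^ 2 ^ k + cnj x ^ 2 ^ k) * of_int (e ^ 2 ^ k) = of_int b" using * by blast
    obtain M where M: "of_int N * (x ^ 2 ^ k + cnj x ^ 2 ^ k) = of_int M"
      using N(2)[of "2 ^ k"] by (auto elim: Ints_cases)
    have "of_int (N * b) = (of_int N * (x ^ 2 ^ k + cnj x ^ 2 ^ k)) * of_int (e ^ 2 ^ k)"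
      by (simp only: of_int_mult b(2)[symmetric] ac_simps)
    also have "\<dots> = of_int (M * e ^ 2 ^ k)" using M by simp
    finally have "N * b = M * e ^ 2 ^ k" by (simp only: of_int_eq_iff)
    then have "e ^ 2 ^ k dvd N * b" by simp
    moreover have "coprime (e ^ 2 ^ k) b" using b(1) by (simp add: coprime_commute)
    ultimately have "e ^ 2 ^ k dvd N" by (simp add: coprime_dvd_mult_left_iff)
    then show ?thesis using N(1) zdvd_imp_le by blast
  qed
  \<comment> \<open>The exponent \<open>k = nat N\<close> is large enough for a contradiction: if
    \<open>e \<ge> 2\<close>, already \<open>e ^ nat N\<close> exceeds \<open>N\<close>.\<close>
  moreover have "N < e ^ 2 ^ nat N" if "e \<noteq> 1"
  proof -
    have "N < 2 ^ nat N" using N(1) of_nat_less_two_power[of "nat N", where 'a = int] by simp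
    also have "\<dots> \<le> e ^ nat N" using e(1) that by (intro power_mono) auto
    also have "\<dots> \<le> e ^ 2 ^ nat N" using e(1) by (intro power_increasing less_imp_le[OF less_exp]) simp
    finally show ?thesis .
  qed
  ultimately have "e = 1" by (meson not_le)
  then show ?thesis using e by simp
qed

text \<open>This is the norm form \<open>r\<^sup>2 + 15 * q\<^sup>2 = n\<close> with
  \<open>r = t / 2\<close> and \<open>q = u / 30\<close>, multiplied by 60. Divisibility by 3 and by
  5 gives \<open>u = 15 * v\<close>, and \<open>t\<^sup>2 + 15 * v\<^sup>2 = 4 * n \<le> 16\<close>
  leaves a finite check.\<close>

lemma quadratic_norm_equation:
  fixes t u n :: int
  assumes "15 * t\<^sup>2 + u\<^sup>2 = 60 * n" "n \<in> {1..4}"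
  shows "(u = 0 \<and> t \<in> {2, -2, 4, -4} \<and> n = (t div 2)\<^sup>2) \<or> (u \<in> {15, -15} \<and> t \<in> {1, -1} \<and> n = 4)"
proof -
  have u2: "u\<^sup>2 = 15 * (4 * n - t\<^sup>2)" using assms(1) by simp
  then have "3 dvd u\<^sup>2" "5 dvd u\<^sup>2" by (auto intro: dvd_mult2)
  moreover have "prime (3::int)" "prime (5::int)" by simp_all
  ultimately have "3 dvd u" "5 dvd u" using prime_dvd_power by blast+
  then have "15 dvd u" by presburger
  then obtain v where v: "u = 15 * v" by blast
  have eq: "t\<^sup>2 + 15 * v\<^sup>2 = 4 * n" using u2 by (simp add: v power2_eq_square)
  have "t\<^sup>2 \<le> 4\<^sup>2" "v\<^sup>2 \<le> 1\<^sup>2"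
    using eq assms(2) zero_le_power2[of t] zero_le_power2[of v] by (simp_all, linarith+)
  then have "\<bar>t\<bar> \<le> 4" "\<bar>v\<bar> \<le> 1"
    using abs_le_square_iff[of t 4] abs_le_square_iff[of v 1] by simp_all
  then have "t \<in> {-4, -3, -2, -1, 0, 1, 2, 3, 4}" "v \<in> {-1, 0, 1}" "n \<in> {1, 2, 3, 4}"
    using assms(2) by auto
  then show ?thesis using eq unfolding v by (elim insertE emptyE) simp_all
qed

lemma csqrt_minus_15: "csqrt (- 15) = \<i> * sqrt 15"
  using csqrt_of_real_nonpos[of "-15"] by simp

lemma norm_layer_minus_15:
  assumes "x \<in> norm_layer (- 15) n" "n \<in> {1..4}"
  shows "x \<in> {1, -1} \<and> n = 1 \<or> x \<in> {2, -2, omega, - omega, cnj omega, - cnj omega} \<and> n = 4"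
proof -
  obtain a b where x: "x = of_rat a + of_rat b * csqrt (of_int (- 15))"
    and alg: "algebraic_int x" and nm: "x * cnj x = of_nat n"
    using assms(1) by (auto simp: norm_layer_def quadratic_integers_def quadratic_field_def)
  define r q :: real where "r = of_rat a" and "q = of_rat b"
  have of_rat: "of_rat z = complex_of_real (of_rat z)" for z
    by (cases z) (simp add: of_rat_rat)
  have xr: "x = Complex r (q * sqrt 15)"
    unfolding x of_rat r_def q_def by (simp add: csqrt_minus_15 complex_eq_iff)
  have rat: "r \<in> \<rat>" "q \<in> \<rat>" by (auto simp: r_def q_def)
  have nq: "r\<^sup>2 + 15 * q\<^sup>2 = n"
    using arg_cong[OF nm, of Re] by (simp add: xr power2_eq_square algebra_simps)
  have tr: "x + cnj x = of_real (2 * r)" by (simp add: xr complex_eq_iff)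
  have "x + cnj x \<in> \<rat>"
  proof -
    have "x + cnj x = of_rat (2 * a)" unfolding tr r_def of_rat[of "2 * a"] by (simp add: of_rat_mult)
    then show ?thesis by simp
  qed
  then have "x + cnj x \<in> \<int>" using algebraic_int_trace_Ints[OF alg] nm by simp
  then obtain t :: int where "x + cnj x = of_int t" by (auto elim: Ints_cases)
  then have t: "2 * r = of_int t" by (metis tr of_real_eq_iff of_real_of_int_eq)
  \<comment> \<open>The factor 30 makes the square integral:
    \<open>900 * q\<^sup>2 = 60 * (n - r\<^sup>2)\<close> with \<open>r = t / 2\<close>. A rational
    number whose square is an integer is itself an integer.\<close>
  have u2: "(30 * q)\<^sup>2 = of_int (15 * (4 * int n - t\<^sup>2))"
    using nq by (simp add: t[symmetric] power2_eq_square algebra_simps)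
  have "algebraic_int (30 * q)"
  proof (rule algebraic_int_root)
    show "poly (monom 1 2) (30 * q) = of_int (15 * (4 * int n - t\<^sup>2))"
      by (simp only: poly_monom u2 mult_1)
  qed (auto simp: degree_monom_eq intro!: int_imp_algebraic_int)
  then have "30 * q \<in> \<int>" by (rule rational_algebraic_int_is_int) (use rat in auto)
  then obtain u where u: "30 * q = of_int u" by (auto elim: Ints_cases)
  have "real_of_int (15 * t\<^sup>2 + u\<^sup>2) = of_int (60 * int n)"
    using u2 by (simp add: u)
  then have "15 * t\<^sup>2 + u\<^sup>2 = 60 * int n" by (simp only: of_int_eq_iff)
  then have tu: "(u = 0 \<and> t \<in> {2, -2, 4, -4} \<and> int n = (t div 2)\<^sup>2) \<or>
      (u \<in> {15, -15} \<and> t \<in> {1, -1} \<and> int n = 4)"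
    using assms(2) by (intro quadratic_norm_equation) auto
  have xtu: "x = Complex (of_int t / 2) (of_int u / 30 * sqrt 15)"
    by (simp add: xr flip: t u)
  have om: "omega = Complex (1 / 2) (sqrt 15 / 2)"
    by (simp add: omega_def csqrt_minus_15 complex_eq_iff)
  \<comment> \<open>The solutions with \<open>u = 0\<close> are the rational integers of modulus 1
    and 2; those with \<open>u = \<plusminus>15\<close> have real part \<plusminus>1/2 and imaginary
    part \<plusminus>sqrt(15)/2, giving \<open>omega\<close> up to sign and conjugation.\<close>
  show ?thesis
    using tu unfolding xtu om
    by (elim disjE conjE insertE emptyE) (simp_all add: complex_eq_iff)
qed

text \<open>Layers 2 and 3 are empty, so every further label lies in layer 4. The modulus feeds the
  row bound, the explicit list the final identification.\<close>

lemma labels_minus_15_cases: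
  assumes "x \<in> labels (- 15)"
  obtains "x \<in> {0, 1, -1}"
  | "cmod x = 2" "x \<in> {2, -2, omega, - omega, cnj omega, - cnj omega}"
proof -
  have "cmod x = 2" if "x \<in> norm_layer (- 15) 4"
  proof -
    have "x * cnj x = 4" using that by (simp add: norm_layer_def)
    then have "complex_of_real ((cmod x)\<^sup>2) = of_real (2\<^sup>2)" by (simp only: complex_norm_square) simp
    then have "(cmod x)\<^sup>2 = 2\<^sup>2" by (simp only: of_real_eq_iff)
    then show ?thesis by (rule power2_eq_imp_eq) auto
  qed
  then show ?thesis
    using assms norm_layer_minus_15[of x 1] norm_layer_minus_15[of x 2]
      norm_layer_minus_15[of x 3] norm_layer_minus_15[of x 4] that
    unfolding labels_def by auto
qed

section \<open>Row norms of Hermitian matrices\<close>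

lemma hermitian_mat_index:
  assumes "hermitian_mat A" "i < dim_row A" "j < dim_row A"
  shows "cnj (A $$ (i, j)) = A $$ (j, i)"
proof -
  have sq: "dim_col A = dim_row A" using assms(1) by (simp add: hermitian_mat_def)
  have "A $$ (j, i) = mat_adjoint A $$ (j, i)" using assms(1) by (simp add: hermitian_mat_def)
  also have "\<dots> = cnj (A $$ (i, j))"
    using assms(2,3) sq by (simp add: mat_adjoint_def mat_of_rows_index)
  finally show ?thesis by simp
qed

lemma hermitian_matI:
  assumes "A \<in> carrier_mat n n"
    and "\<And>i j. i < n \<Longrightarrow> j < n \<Longrightarrow> cnj (A $$ (i, j)) = A $$ (j, i)"
  shows "hermitian_mat A"
  unfolding hermitian_mat_def
proof
  show "square_mat A" using assms(1) by simp
  show "mat_adjoint A = A"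
    by (rule eq_matI) (use assms in \<open>auto simp: mat_adjoint_def mat_of_rows_index\<close>)
qed

text \<open>Column \<open>j\<close> is the conjugate of row \<open>j\<close>, so the entries of the
  square are inner products of rows. In particular its diagonal consists of the squared row
  norms.\<close>

lemma hermitian_mat_square_index:
  assumes "hermitian_mat A" "A \<in> carrier_mat n n" "i < n" "j < n"
  shows "(A * A) $$ (i, j) = (\<Sum>k<n. A $$ (i, k) * cnj (A $$ (j, k)))"
  using assms hermitian_mat_index[OF assms(1)]
  by (auto simp: scalar_prod_def atLeast0LessThan intro!: sum.cong)

lemma hermitian_mat_square:
  assumes "hermitian_mat A" "A \<in> carrier_mat n n"
  shows "hermitian_mat (A * A)"
proof (rule hermitian_matI)
  show "A * A \<in> carrier_mat n n" using assms(2) by simp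
  fix i j assume "i < n" "j < n"
  then show "cnj ((A * A) $$ (i, j)) = (A * A) $$ (j, i)"
    unfolding hermitian_mat_square_index[OF assms \<open>i < n\<close> \<open>j < n\<close>]
      hermitian_mat_square_index[OF assms \<open>j < n\<close> \<open>i < n\<close>]
    by (simp add: mult.commute)
qed

lemma hermitian_mat_square_diag:
  assumes "hermitian_mat A" "A \<in> carrier_mat n n" "i < n"
  shows "(A * A) $$ (i, i) = of_real (\<Sum>k<n. (cmod (A $$ (i, k)))\<^sup>2)"
  unfolding hermitian_mat_square_index[OF assms assms(3)]
  by (simp add: complex_norm_square del: of_real_power)

lemma pow_mat_add:
  assumes "A \<in> carrier_mat n n"
  shows "A ^\<^sub>m (k + l) = A ^\<^sub>m k * A ^\<^sub>m l"
proof (induction l)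
  case 0
  show ?case using assms pow_carrier_mat[OF assms, of k] by simp
next
  case (Suc l)
  then show ?case
    using assoc_mult_mat[OF pow_carrier_mat[OF assms] pow_carrier_mat[OF assms] assms] by simp
qed

lemma hermitian_mat_pow_two_power:
  assumes "hermitian_mat A" "A \<in> carrier_mat n n"
  shows "hermitian_mat (A ^\<^sub>m 2 ^ k)"
proof (induction k)
  case 0
  show ?case using assms by simp
next
  case (Suc k)
  then show ?case
    using hermitian_mat_square[OF _ pow_carrier_mat[OF assms(2)]]
    by (simp add: mult_2 pow_mat_add[OF assms(2)])
qed

text \<open>A diagonal entry of \<open>H * H\<close> is the squared norm of a row of
  \<open>H\<close>, hence at least the squared modulus of the diagonal entry of \<open>H\<close>;
  each doubling of the exponent thus at least squares the bound. The exponents differ by one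
  doubling because the base is already an entry of \<open>A * A\<close>.\<close>

lemma hermitian_mat_pow_diag_lower_bound:
  assumes "hermitian_mat A" "A \<in> carrier_mat n n" "i < n"
  shows "(\<Sum>k<n. (cmod (A $$ (i, k)))\<^sup>2) ^ 2 ^ m \<le> cmod ((A ^\<^sub>m 2 ^ Suc m) $$ (i, i))"
proof (induction m)
  case 0
  have "A ^\<^sub>m 2 = A * A" using assms(2) by (simp add: numeral_2_eq_2)
  then show ?case
    using hermitian_mat_square_diag[OF assms] by (simp add: sum_nonneg del: of_real_sum)
next
  case (Suc m)
  define H where "H = A ^\<^sub>m 2 ^ Suc m"
  have H: "hermitian_mat H" "H \<in> carrier_mat n n"
    unfolding H_def
    using hermitian_mat_pow_two_power[OF assms(1,2)] pow_carrier_mat[OF assms(2)] by blast+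
  have HH: "A ^\<^sub>m 2 ^ Suc (Suc m) = H * H"
    unfolding H_def by (subst pow_mat_add[OF assms(2), symmetric]) (simp add: mult_2)
  have "(\<Sum>k<n. (cmod (A $$ (i, k)))\<^sup>2) ^ 2 ^ Suc m = ((\<Sum>k<n. (cmod (A $$ (i, k)))\<^sup>2) ^ 2 ^ m)\<^sup>2"
    by (simp add: power_mult[symmetric] mult.commute)
  also have "\<dots> \<le> (cmod (H $$ (i, i)))\<^sup>2"
    unfolding H_def by (intro power_mono Suc zero_le_power sum_nonneg) simp
  also have "\<dots> \<le> (\<Sum>k<n. (cmod (H $$ (i, k)))\<^sup>2)"
    using assms(3) by (intro member_le_sum) auto
  also have "\<dots> = cmod ((H * H) $$ (i, i))"
    using hermitian_mat_square_diag[OF H assms(3)] by (simp add: sum_nonneg del: of_real_sum)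
  finally show ?case by (simp only: HH)
qed

lemma eigenvalue_smult:
  fixes A :: "complex mat"
  assumes "A \<in> carrier_mat n n" "c \<noteq> 0" "eigenvalue (c \<cdot>\<^sub>m A) k"
  shows "eigenvalue A (k / c)"
proof -
  obtain v where v: "v \<in> carrier_vec n" "v \<noteq> 0\<^sub>v n" "c \<cdot>\<^sub>m A *\<^sub>v v = k \<cdot>\<^sub>v v"
    using assms by (auto simp: eigenvalue_def eigenvector_def)
  have "A *\<^sub>v v = (1 / c) \<cdot>\<^sub>v (c \<cdot>\<^sub>m A *\<^sub>v v)"
    by (rule eq_vecI) (use assms v(1) in auto)
  also have "\<dots> = (k / c) \<cdot>\<^sub>v v" unfolding v(3) by (simp add: smult_smult_assoc)
  finally show ?thesis using v assms by (auto simp: eigenvalue_def eigenvector_def)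
qed

text \<open>If the squared row norm exceeded \<open>\<rho>\<^sup>2\<close>, repeated squaring would make a diagonal entry of
  the powers of a suitable rescaling with spectral radius below \<open>1\<close> grow without bound.\<close>

lemma hermitian_mat_row_norm_le:
  assumes A: "hermitian_mat A" "A \<in> carrier_mat n n" "i < n"
    and ev: "\<And>k. eigenvalue A k \<Longrightarrow> cmod k \<le> \<rho>" and "0 \<le> \<rho>"
  shows "(\<Sum>k<n. (cmod (A $$ (i, k)))\<^sup>2) \<le> \<rho>\<^sup>2"
proof (rule ccontr)
  define S where "S = (\<Sum>k<n. (cmod (A $$ (i, k)))\<^sup>2)"
  assume "\<not> ?thesis"
  then have "\<rho> < sqrt S" using \<open>0 \<le> \<rho>\<close> by (simp add: S_def real_less_rsqrt)
  \<comment> \<open>Division by any \<open>r\<close> strictly between moves all eigenvalues inside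
    the open unit disc and keeps the squared row norm above 1.\<close>
  then obtain r where r: "\<rho> < r" "r < sqrt S" using dense by blast
  have r0: "r > 0" using r \<open>0 \<le> \<rho>\<close> by simp
  have "r\<^sup>2 < (sqrt S)\<^sup>2" using r r0 by (intro power_strict_mono) auto
  then have rS: "r\<^sup>2 < S" by (simp add: S_def sum_nonneg)
  define B where "B = complex_of_real (1 / r) \<cdot>\<^sub>m A"
  have B: "B \<in> carrier_mat n n" using A by (simp add: B_def)
  have Bh: "hermitian_mat B"
    by (rule hermitian_matI[OF B])
      (use A hermitian_mat_index[OF A(1)] in \<open>auto simp: B_def\<close>)
  have evB: "cmod k < 1" if "eigenvalue B k" for k
  proof -
    have "eigenvalue A (k / of_real (1 / r))"
      using that r0 A(2) unfolding B_def by (intro eigenvalue_smult) auto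
    then have "cmod k * r \<le> \<rho>" using ev[of "k / of_real (1 / r)"] r0 by (simp add: norm_mult)
    then have "cmod k * r < 1 * r" using r by simp
    then show ?thesis using r0 by (simp only: mult_less_cancel_right_pos)
  qed
  \<comment> \<open>The index \<open>i < n\<close> makes the dimension positive, so the spectral
    radius is attained at an eigenvalue.\<close>
  have "spectral_radius B < 1"
    using spectral_radius_mem_max(1)[OF B] A(3) evB by (auto simp: spectrum_def)
  \<comment> \<open>Spectral radius below 1 bounds the entries of all powers by a single
    constant.\<close>
  then obtain c where c: "\<And>k. norm_bound (B ^\<^sub>m k) c"
    using spectral_radius_jnf_norm_bound_less_1_upper_triangular[OF B] by blast
  define s where "s = (\<Sum>k<n. (cmod (B $$ (i, k)))\<^sup>2)"
  have "s = S / r\<^sup>2"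
    unfolding s_def S_def sum_divide_distrib
    using A r0 by (intro sum.cong) (auto simp: B_def norm_mult norm_divide power_divide)
  then have "s > 1" using rS r0 by simp
  then obtain m where m: "c < s ^ m" using real_arch_pow by blast
  also have "\<dots> \<le> s ^ 2 ^ m" using \<open>s > 1\<close> by (intro power_increasing) (auto intro: less_imp_le)
  also have "\<dots> \<le> cmod ((B ^\<^sub>m 2 ^ Suc m) $$ (i, i))"
    unfolding s_def by (rule hermitian_mat_pow_diag_lower_bound[OF Bh B A(3)])
  also have "\<dots> \<le> c" using c[of "2 ^ Suc m"] B A(3) by (auto simp: norm_bound_def)
  finally show False by simp
qed

section \<open>Isolated pairs and equivalence\<close>

text \<open>Column \<open>j\<close> of \<open>P\<close> has its 1 in row \<open>p j\<close>, so
  \<open>P\<close> sends the basis vector \<open>j\<close> to \<open>p j\<close>; this is why the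
  inverse permutation appears in the indices.\<close>

lemma permutation_mat_conjugate:
  fixes A :: "complex mat"
  assumes "A \<in> carrier_mat n n" "p permutes {..<n}"
  defines "P \<equiv> mat n n (\<lambda>(i, j). if i = p j then 1 else 0)"
  shows "P * A * transpose_mat P = mat n n (\<lambda>(i, j). A $$ (inv_into UNIV p i, inv_into UNIV p j))"
proof (rule eq_matI)
  fix i j assume "i < dim_row (mat n n (\<lambda>(i, j). A $$ (inv_into UNIV p i, inv_into UNIV p j)))"
    "j < dim_col (mat n n (\<lambda>(i, j). A $$ (inv_into UNIV p i, inv_into UNIV p j)))"
  then have ij: "i < n" "j < n" by auto
  have eq: "a = p b \<longleftrightarrow> b = inv_into UNIV p a" for a b
    using permutes_inv_eq[OF assms(2), of a b] by metis
  have lt: "inv_into UNIV p a < n" if "a < n" for a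
    using permutes_in_image[OF permutes_inv[OF assms(2)], of a] that by auto
  have PA: "(P * A) $$ (i, k) = A $$ (inv_into UNIV p i, k)" if "k < n" for k
    using ij(1) that assms(1) lt[of i]
    by (simp add: P_def scalar_prod_def eq if_distrib[where f = "\<lambda>x. x * _"] cong: if_cong)
  have "(P * A * transpose_mat P) $$ (i, j) = (\<Sum>k<n. (P * A) $$ (i, k) * P $$ (j, k))"
    using ij assms(1) by (simp add: P_def scalar_prod_def atLeast0LessThan)
  also have "\<dots> = (\<Sum>k<n. if k = inv_into UNIV p j then A $$ (inv_into UNIV p i, k) else 0)"
    using ij PA by (intro sum.cong) (auto simp: P_def eq)
  also have "\<dots> = A $$ (inv_into UNIV p i, inv_into UNIV p j)" using lt ij by simp
  finally show "(P * A * transpose_mat P) $$ (i, j) =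
      mat n n (\<lambda>(i, j). A $$ (inv_into UNIV p i, inv_into UNIV p j)) $$ (i, j)" using ij by simp
qed (use assms in auto)

text \<open>Moving \<open>i\<close> and \<open>j\<close> to positions 0 and 1 produces blocks of
  sizes 2 and \<open>n - 2\<close>; the second is nonempty because \<open>2 < n\<close>.\<close>

lemma not_connected_mat_if_isolated_pair:
  assumes A: "A \<in> carrier_mat n n" and n: "2 < n" and ij: "i < n" "j < n" "i \<noteq> j"
    and iso: "\<And>a k. a \<in> {i, j} \<Longrightarrow> k < n \<Longrightarrow> k \<notin> {i, j} \<Longrightarrow> A $$ (a, k) = 0 \<and> A $$ (k, a) = 0"
  shows "\<not> connected_mat A"
proof -
  \<comment> \<open>\<open>j'\<close> is the place to which the first transposition sends
    \<open>j\<close>. It is nonzero because \<open>i \<noteq> j\<close>, so the swap of 1 and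
    \<open>j'\<close> leaves \<open>i\<close> at position 0.\<close>
  define j' where "j' = transpose 0 i j"
  define p where "p = transpose 1 j' \<circ> transpose 0 i"
  have j': "j' < n" "j' \<noteq> 0"
    using ij n unfolding j'_def by (auto simp: transpose_def)
  have p: "p permutes {..<n}"
    unfolding p_def using ij n j' by (intro permutes_compose permutes_swap_id) auto
  have pi: "p i = 0" and pj: "p j = 1"
    using j' by (simp_all add: p_def j'_def[symmetric])
  define q where "q = inv_into UNIV p"
  have q01: "q 0 = i" "q 1 = j"
    using permutes_inverses(2)[OF p] pi pj unfolding q_def by metis+
  have qp: "p (q a) = a" for a unfolding q_def using permutes_inverses(1)[OF p] by simp
  have q_lt: "q a < n" if "a < n" for a
    using permutes_in_image[OF permutes_inv[OF p], of a] that by (auto simp: q_def)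
  have q_big: "q a \<notin> {i, j}" if "2 \<le> a" for a
    using qp[of a] pi pj that by auto
  have q_small: "q a \<in> {i, j}" if "a < 2" for a
    using that q01 by (auto simp: less_2_cases_iff)
  define P where "P = mat n n (\<lambda>(i, j). if i = p j then 1 else (0::complex))"
  define f where "f = (\<lambda>(a, b). A $$ (q a, q b))"
  define B1 where "B1 = mat 2 2 f"
  define B2 where "B2 = mat (n - 2) (n - 2) (\<lambda>(a, b). f (a + 2, b + 2))"
  have "P * A * transpose_mat P = mat n n f"
    unfolding P_def f_def q_def by (rule permutation_mat_conjugate[OF A p])
  also have "\<dots> = diag_block_mat [B1, B2]"
  proof (rule eq_matI)
    fix a b assume "a < dim_row (diag_block_mat [B1, B2])" "b < dim_col (diag_block_mat [B1, B2])"
    then have ab: "a < n" "b < n" using n by (auto simp: B1_def B2_def Let_def)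
    have "f (a, b) = 0" if "a < 2" "\<not> b < 2"
      using iso[OF q_small[OF that(1)] q_lt[OF ab(2)]] q_big[of b] that by (simp add: f_def)
    moreover have "f (a, b) = 0" if "\<not> a < 2" "b < 2"
      using iso[OF q_small[OF that(2)] q_lt[OF ab(1)]] q_big[of a] that by (simp add: f_def)
    moreover have "a = a - 2 + 2" if "\<not> a < 2" for a :: nat using that by simp
    ultimately show "mat n n f $$ (a, b) = diag_block_mat [B1, B2] $$ (a, b)"
      using ab n by (cases "a < 2"; cases "b < 2") (auto simp: B1_def B2_def Let_def)
  qed (use n in \<open>auto simp: B1_def B2_def Let_def\<close>)
  finally have "P * A * transpose_mat P = diag_block_mat [B1, B2]" .
  moreover have "permutation_mat (dim_row A) P"
    unfolding permutation_mat_def using p A by (auto simp: P_def)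
  moreover have "\<forall>B\<in>set [B1, B2]. square_mat B \<and> dim_row B > 0"
    using n by (auto simp: B1_def B2_def)
  moreover have "length [B1, B2] > 1" by simp
  ultimately show ?thesis unfolding connected_mat_def by blast
qed

text \<open>Identity matrices serve as both the permutation and the sign matrix.\<close>

lemma equivalent_matI:
  assumes "A \<in> carrier_mat n n" "X \<in> {A, - A, map_mat cnj A, - map_mat cnj A}"
  shows "equivalent_mat A X"
proof -
  have "permutation_mat n (1\<^sub>m n)"
    unfolding permutation_mat_def
    by (rule exI[of _ id]) (auto simp: permutes_id one_mat_def)
  moreover have "sign_mat n (1\<^sub>m n)" by (auto simp: sign_mat_def diagonal_mat_def)
  moreover have "X \<in> carrier_mat n n" using assms by auto
  then have "X = 1\<^sub>m n * 1\<^sub>m n * X * transpose_mat (1\<^sub>m n) * 1\<^sub>m n" by simp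
  moreover have "dim_row A = n" using assms(1) by simp
  ultimately show ?thesis using assms(2) unfolding equivalent_mat_def by blast
qed

section \<open>Entries of modulus 2 in cyclotomic graphs\<close>

lemma cyclotomic_row_norm_le:
  assumes "hermitian_mat A" "cyclotomic A" "A \<in> carrier_mat n n" "i < n"
  shows "(\<Sum>k<n. (cmod (A $$ (i, k)))\<^sup>2) \<le> 4"
proof -
  have "cmod k \<le> 2" if "eigenvalue A k" for k
  proof -
    have "k \<in> complex_of_real ` {-2..2}" using assms(2) that by (simp add: cyclotomic_def)
    then show ?thesis by auto
  qed
  then have "(\<Sum>k<n. (cmod (A $$ (i, k)))\<^sup>2) \<le> 2\<^sup>2"
    by (intro hermitian_mat_row_norm_le) (use assms in auto)
  then show ?thesis by simp
qed

text \<open>An entry of modulus 2 exhausts the bound 4 on the squared norm of its row.\<close>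

lemma cyclotomic_row_isolated:
  assumes A: "hermitian_mat A" "cyclotomic A" "A \<in> carrier_mat n n"
    and "i < n" "j < n" "cmod (A $$ (i, j)) = 2" "k < n" "k \<noteq> j"
  shows "A $$ (i, k) = 0"
proof -
  have "(cmod (A $$ (i, k)))\<^sup>2 + (cmod (A $$ (i, j)))\<^sup>2 = (\<Sum>l\<in>{k, j}. (cmod (A $$ (i, l)))\<^sup>2)"
    using assms by simp
  also have "\<dots> \<le> (\<Sum>l<n. (cmod (A $$ (i, l)))\<^sup>2)"
    using assms by (intro sum_mono2) auto
  also have "\<dots> \<le> 4" by (rule cyclotomic_row_norm_le) (use assms in auto)
  finally show ?thesis using assms by simp
qed

text \<open>Under negation and conjugation the six values form two orbits, those of 2 and of
  \<open>omega\<close>.\<close>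

lemma equivalent_to_S2_or_S2_star:
  assumes A: "A \<in> carrier_mat 2 2" "hermitian_mat A"
    and diag: "A $$ (0, 0) = 0" "A $$ (1, 1) = 0"
    and z: "A $$ (0, 1) \<in> {2, -2, omega, - omega, cnj omega, - cnj omega}"
  shows "equivalent_mat A S2 \<or> equivalent_mat A S2_star"
proof -
  have A10: "A $$ (1, 0) = cnj (A $$ (0, 1))"
    using hermitian_mat_index[OF A(2), of 0 1] A(1) by simp
  have dims: "S2 \<in> carrier_mat 2 2" "S2_star \<in> carrier_mat 2 2"
    by (auto simp: S2_def S2_star_def mat_of_rows_list_def)
  have eq: "X = Y" if "X \<in> carrier_mat 2 2" "Y \<in> carrier_mat 2 2" "X $$ (0, 0) = Y $$ (0, 0)"
    "X $$ (0, 1) = Y $$ (0, 1)" "X $$ (1, 0) = Y $$ (1, 0)" "X $$ (1, 1) = Y $$ (1, 1)"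
    for X Y :: "complex mat"
    by (rule eq_matI) (use that in \<open>auto simp: less_2_cases_iff\<close>)
  have ent: "S2 $$ (0, 0) = 0" "S2 $$ (0, 1) = 2" "S2 $$ (1, 0) = 2" "S2 $$ (1, 1) = 0"
    "S2_star $$ (0, 0) = 0" "S2_star $$ (0, 1) = omega" "S2_star $$ (1, 0) = cnj omega"
    "S2_star $$ (1, 1) = 0"
    by (auto simp: S2_def S2_star_def mat_of_rows_list_def)
  note entries = ent A10 diag
  from z consider "A $$ (0, 1) = 2" | "A $$ (0, 1) = - 2" | "A $$ (0, 1) = omega"
    | "A $$ (0, 1) = - omega" | "A $$ (0, 1) = cnj omega" | "A $$ (0, 1) = - cnj omega"
    by blast
  then show ?thesis
  proof cases
    case 1
    have "S2 = A" by (rule eq) (use 1 entries A dims in auto)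
    then show ?thesis using equivalent_matI[OF A(1), of S2] by simp
  next
    case 2
    have "S2 = - A" by (rule eq) (use 2 entries A dims in auto)
    then show ?thesis using equivalent_matI[OF A(1), of S2] by simp
  next
    case 3
    have "S2_star = A" by (rule eq) (use 3 entries A dims in auto)
    then show ?thesis using equivalent_matI[OF A(1), of S2_star] by simp
  next
    case 4
    have "S2_star = - A" by (rule eq) (use 4 entries A dims in auto)
    then show ?thesis using equivalent_matI[OF A(1), of S2_star] by simp
  next
    case 5
    have "S2_star = map_mat cnj A" by (rule eq) (use 5 entries A dims in auto)
    then show ?thesis using equivalent_matI[OF A(1), of S2_star] by simp
  next
    case 6
    have "S2_star = - map_mat cnj A" by (rule eq) (use 6 entries A dims in auto)
    then show ?thesis using equivalent_matI[OF A(1), of S2_star] by simp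
  qed
qed

theorem theorem7:
  fixes A :: "complex mat"
  assumes "maximal_L_graph (-15) A"
    and "\<not> (\<exists>B. charged_signed_graph (-15) B \<and> equivalent_mat A B)"
  shows "equivalent_mat A S2 \<or> equivalent_mat A S2_star"
proof -
  define n where "n = dim_row A"
  have L: "L_graph (-15) A" and cyc: "cyclotomic A" and conn: "connected_mat A"
    using assms(1) by (auto simp: maximal_L_graph_def connected_cyclotomic_L_graph_def)
  have herm: "hermitian_mat A" using L by (simp add: L_graph_def)
  have A: "A \<in> carrier_mat n n"
    using herm by (auto simp: hermitian_mat_def n_def)
  note isolated = cyclotomic_row_isolated[OF herm cyc A]
  \<comment> \<open>Equivalence is reflexive, so \<open>A\<close> itself must have an entry outside
    \<open>{0, 1, -1}\<close>; charges are excluded, so it lies off the diagonal.\<close>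
  have "\<not> charged_signed_graph (-15) A"
    using assms(2) equivalent_matI[OF A, of A] by auto
  then obtain i j where ij: "i < n" "j < n" and notin: "A $$ (i, j) \<notin> {0, 1, -1}"
    using L A unfolding charged_signed_graph_def by fastforce
  then have "i \<noteq> j" using L unfolding L_graph_def n_def by auto
  then have lab: "A $$ (a, b) \<in> labels (-15)" if "a = i \<and> b = j \<or> a = j \<and> b = i" for a b
    using L ij that unfolding L_graph_def n_def by auto
  have Aij: "cmod (A $$ (i, j)) = 2"
    using lab[of i j] notin by (auto elim!: labels_minus_15_cases)
  have "A $$ (j, i) = cnj (A $$ (i, j))"
    using hermitian_mat_index[OF herm, of i j] ij by (simp add: n_def)
  then have Aji: "cmod (A $$ (j, i)) = 2" using Aij by simp
  have iso: "A $$ (a, k) = 0 \<and> A $$ (k, a) = 0" if "a \<in> {i, j}" "k < n" "k \<notin> {i, j}" for a k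
  proof -
    have "A $$ (a, k) = 0"
      using that isolated[OF ij Aij, of k] isolated[OF ij(2,1) Aji, of k] by auto
    moreover have "A $$ (k, a) = cnj (A $$ (a, k))"
      using hermitian_mat_index[OF herm, of a k] that ij by (auto simp: n_def)
    ultimately show ?thesis by simp
  qed
  have "\<not> 2 < n"
    using not_connected_mat_if_isolated_pair[OF A _ ij \<open>i \<noteq> j\<close> iso] conn by blast
  then have n2: "n = 2" and cases: "i = 0 \<and> j = 1 \<or> i = 1 \<and> j = 0" using ij \<open>i \<noteq> j\<close> by auto
  have A01: "cmod (A $$ (0, 1)) = 2" using cases Aij Aji by auto
  have "A $$ (0, 1) \<in> labels (-15)" using lab[of 0 1] cases by auto
  then have "A $$ (0, 1) \<in> {2, -2, omega, - omega, cnj omega, - cnj omega}"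
    by (rule labels_minus_15_cases) (use A01 in auto)
  \<comment> \<open>Isolation within a row also covers its diagonal entry, so both charges
    vanish.\<close>
  moreover have "A $$ (0, 0) = 0" "A $$ (1, 1) = 0"
    using isolated[OF ij Aij ij(1)] isolated[OF ij(2,1) Aji ij(2)] cases by auto
  ultimately show ?thesis using A herm n2 by (intro equivalent_to_S2_or_S2_star) auto
qed

end
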